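(* For every integer $n\ge 1$, the set of labeled interval orders on $[n]$ is in bijection with the disjoint union $$\bigsqcup_{S\subseteq [n-1]} \boldsymbol{\alpha}_n(S)\times\boldsymbol{\lambda}_n(S),$$ which may alternatively be written as the set $$\{(\pi,\tau)\in\mathcal{S}_n\times\mathcal{S}_n : D(\pi)\subseteq A(\tau)\}.$$
   Context: $[n]=\{1,\dots,n\}$ and $\mathcal{S}_n$ is the set of permutations of $[n]$, written as words $\pi=a_1a_2\cdots a_n$. The set of descent positions of $\pi$ is $D(\pi)=\{i\in[n-1] : a_i>a_{i+1}\}$. The set of ascent bottoms of $\pi$ is the set of values $A(\pi)=\{a_i : i\in[n-1],\ a_i<a_{i+1}\}$. For $S\subseteq[n-1]$, $\boldsymbol{\alpha}_n(S)=\{\pi\in\mathcal{S}_n : D(\pi)\subseteq S\}$ and $\boldsymbol{\lambda}_n(S)=\{\pi\in\mathcal{S}_n : A(\pi)= S\}$. A poset $P$ is an interval order if each $z\in P$ can be assigned a closed real interval $[l_z,r_z]$ such that $x<_P y$ if and only if $r_x<l_y$. A labeled interval order on $[n]$ is a partial order on the set $[n]$ that is an interval order (two such are the same only if they are equal as relations on $[n]$). *)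

theory Defs
  imports Complex_Main "HOL-Combinatorics.Permutations"
begin

text \<open>
  A permutation \<open>p permutes {1..n}\<close> represents the word \<open>p 1, p 2, \<dots>, p n\<close>.
\<close>

definition descent_positions :: "nat \<Rightarrow> (nat \<Rightarrow> nat) \<Rightarrow> nat set" where
  "descent_positions n p = {i \<in> {1..n - 1}. p i > p (i + 1)}"

text \<open>Unlike descents, which are recorded by position, ascents are recorded by value.\<close>

definition ascent_bottoms :: "nat \<Rightarrow> (nat \<Rightarrow> nat) \<Rightarrow> nat set" where
  "ascent_bottoms n p = {p i | i. i \<in> {1..n - 1} \<and> p i < p (i + 1)}"

definition perms_descents_within :: "nat \<Rightarrow> nat set \<Rightarrow> (nat \<Rightarrow> nat) set" where
  "perms_descents_within n S = {p. p permutes {1..n} \<and> descent_positions n p \<subseteq> S}"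

definition perms_ascent_bottoms_eq :: "nat \<Rightarrow> nat set \<Rightarrow> (nat \<Rightarrow> nat) set" where
  "perms_ascent_bottoms_eq n S = {p. p permutes {1..n} \<and> ascent_bottoms n p = S}"

text \<open>
  Orders are reflexive relations \<open>R \<subseteq> A \<times> A\<close>, so the strict order that the intervals
  represent is \<open>(x, y) \<in> R \<and> x \<noteq> y\<close>.
\<close>

definition interval_order_on :: "'a set \<Rightarrow> 'a rel \<Rightarrow> bool" where
  "interval_order_on A R \<longleftrightarrow> partial_order_on A R \<and>
     (\<exists>l r :: 'a \<Rightarrow> real.
        (\<forall>z\<in>A. l z \<le> r z) \<and>
        (\<forall>x\<in>A. \<forall>y\<in>A. ((x, y) \<in> R \<and> x \<noteq> y) \<longleftrightarrow> r x < l y))"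

definition labeled_interval_orders :: "nat \<Rightarrow> nat rel set" where
  "labeled_interval_orders n = {R. interval_order_on {1..n} R}"

end

theory Submission
  imports Defs
begin

text \<open>
  An interval order has a unique representation by intervals \<open>[l x, r x]\<close> with natural endpoints
  such that \<open>l\<close> and \<open>r\<close> have the same image and \<open>r x\<close> is the number of \<open>y\<close> with
  \<open>r y < r x\<close>; here \<open>l x\<close> is the number of elements below \<open>x\<close>. Let \<open>p\<close> list \<open>[n]\<close> by
  increasing \<open>r\<close>, ties in label order, and let \<open>c i = l (p i)\<close>. Then \<open>c i < i\<close>, and every
  descent position of \<open>p\<close> is a value of \<open>r\<close>, hence of \<open>c\<close>. Conversely \<open>r (p i)\<close> is the
  largest value of \<open>c\<close> below \<open>i\<close>, so interval orders correspond to the pairs \<open>(p, c)\<close> with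
  \<open>c i < i\<close> and all descent positions of \<open>p\<close> among the values of \<open>c\<close>. Finally, such functions
  \<open>c\<close> correspond to permutations \<open>q\<close>: let \<open>c m\<close> be the last entry smaller than \<open>m\<close> to the
  left of \<open>m\<close> in the word \<open>q\<close>, or 0. The nonzero values of \<open>c\<close> are the ascent bottoms of \<open>q\<close>.
\<close>

section \<open>Sorting permutations\<close>

lemma strict_mono_on_permutes_rank:
  fixes f :: "nat \<Rightarrow> 'a::linorder"
  assumes p: "p permutes {1..n}" and mono: "strict_mono_on {1..n} (f \<circ> p)" and i: "i \<in> {1..n}"
  shows "card {y \<in> {1..n}. f y < f (p i)} = i - 1"
proof -
  have "{y \<in> {1..n}. f y < f (p i)} = p ` {1..<i}"
  proof (intro equalityI subsetI)
    fix y assume y: "y \<in> {y \<in> {1..n}. f y < f (p i)}"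
    then obtain j where j: "j \<in> {1..n}" "y = p j"
      using permutes_image[OF p] by blast
    with y have "j < i"
      using strict_mono_on_leD[OF mono i j(1)] by (auto simp: not_less[symmetric])
    with j show "y \<in> p ` {1..<i}" by auto
  next
    fix y assume "y \<in> p ` {1..<i}"
    then obtain j where j: "1 \<le> j" "j < i" "y = p j" by auto
    then have "j \<in> {1..n}" using i by auto
    with j show "y \<in> {y \<in> {1..n}. f y < f (p i)}"
      using strict_mono_onD[OF mono _ i] permutes_in_image[OF p] by auto
  qed
  then show ?thesis
    using card_image[OF inj_on_subset[OF permutes_inj[OF p]], of "{1..<i}"] by simp
qed

text \<open>The rank formula recovers the position of a value from the keys alone. This uniqueness
  settles the injectivity of \<open>order_of_perm_code\<close> and of
  \<open>nearest_smaller\<close>.\<close>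

lemma strict_mono_on_permutes_unique:
  fixes f :: "nat \<Rightarrow> 'a::linorder"
  assumes p: "p permutes {1..n}" "strict_mono_on {1..n} (f \<circ> p)"
    and q: "q permutes {1..n}" "strict_mono_on {1..n} (f \<circ> q)"
  shows "p = q"
proof
  fix i
  show "p i = q i"
  proof (cases "i \<in> {1..n}")
    case True
    then obtain j where j: "j \<in> {1..n}" "p i = q j"
      using permutes_image[OF q(1)] permutes_in_image[OF p(1)] by (metis imageE)
    have "i - 1 = j - 1"
      using strict_mono_on_permutes_rank[OF p True] strict_mono_on_permutes_rank[OF q j(1)] j(2)
      by simp
    with True j show ?thesis by (auto simp: eq_diff_iff)
  qed (use p(1) q(1) in \<open>simp add: permutes_not_in\<close>)
qed

lemma ex_strict_mono_on_permutes:
  fixes f :: "nat \<Rightarrow> 'a::linorder"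
  assumes f: "inj_on f {1..n}"
  shows "\<exists>p. p permutes {1..n} \<and> strict_mono_on {1..n} (f \<circ> p)"
proof -
  define L where "L = sorted_list_of_set (f ` {1..n})"
  have len: "length L = n" and set: "set L = f ` {1..n}" and sorted: "sorted_wrt (<) L"
    using card_image[OF f] by (auto simp: L_def)
  define p where "p i = (if i \<in> {1..n} then the_inv_into {1..n} f (L ! (i - 1)) else i)" for i
  have Lmem: "L ! (i - 1) \<in> f ` {1..n}" if "i \<in> {1..n}" for i
    using that len set nth_mem[of "i - 1" L] by (metis One_nat_def Suc_pred atLeastAtMost_iff less_eq_Suc_le)
  have fp: "f (p i) = L ! (i - 1)" if "i \<in> {1..n}" for i
    using that f_the_inv_into_f[OF f Lmem[OF that]] by (simp add: p_def)
  have mono: "strict_mono_on {1..n} (f \<circ> p)"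
  proof (rule strict_mono_onI)
    fix i j assume ij: "i \<in> {1..n}" "j \<in> {1..n}" "i < j"
    then have "i - 1 < j - 1" "j - 1 < length L" using len by auto
    then have "L ! (i - 1) < L ! (j - 1)"
      using sorted sorted_wrt_nth_less by blast
    then show "(f \<circ> p) i < (f \<circ> p) j" using fp ij by simp
  qed
  have "inj_on p {1..n}"
    using strict_mono_on_imp_inj_on[OF mono] inj_on_imageI2 by blast
  moreover have "p ` {1..n} \<subseteq> {1..n}"
    using the_inv_into_into[OF f Lmem order_refl] by (auto simp: p_def)
  ultimately have "bij_betw p {1..n} {1..n}"
    by (simp add: bij_betw_def endo_inj_surj)
  then have "p permutes {1..n}"
    by (rule bij_imp_permutes) (auto simp: p_def)
  with mono show ?thesis by blast
qed

section \<open>Canonical representations of interval orders\<close>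

definition canonical_rep :: "'a set \<Rightarrow> ('a \<Rightarrow> nat) \<Rightarrow> ('a \<Rightarrow> nat) \<Rightarrow> bool" where
  "canonical_rep A l r \<longleftrightarrow> l ` A = r ` A \<and> (\<forall>x\<in>A. l x \<le> r x) \<and>
     (\<forall>x\<in>A. r x = card {y \<in> A. r y < r x})"

definition order_of_rep :: "'a set \<Rightarrow> ('a \<Rightarrow> nat) \<Rightarrow> ('a \<Rightarrow> nat) \<Rightarrow> 'a rel" where
  "order_of_rep A l r = {(x, y) \<in> A \<times> A. x = y \<or> r x < l y}"

lemma interval_order_on_order_of_rep:
  assumes "\<And>x. x \<in> A \<Longrightarrow> l x \<le> r x"
  shows "interval_order_on A (order_of_rep A l r)"
proof -
  have "partial_order_on A (order_of_rep A l r)"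
    unfolding partial_order_on_def preorder_on_def
  proof (intro conjI)
    show "refl_on A (order_of_rep A l r)"
      by (auto simp: refl_on_def order_of_rep_def)
    show "trans (order_of_rep A l r)"
      by (rule transI) (use assms in \<open>fastforce simp: order_of_rep_def\<close>)
    show "antisym (order_of_rep A l r)"
    proof (rule antisymI)
      fix x y assume "(x, y) \<in> order_of_rep A l r" "(y, x) \<in> order_of_rep A l r"
      then show "x = y"
        using assms[of x] assms[of y] by (auto simp: order_of_rep_def)
    qed
  qed (auto simp: order_of_rep_def)
  moreover have "\<forall>x\<in>A. \<forall>y\<in>A. ((x, y) \<in> order_of_rep A l r \<and> x \<noteq> y) \<longleftrightarrow> real (r x) < real (l y)"
    using assms by (fastforce simp: order_of_rep_def)
  ultimately show ?thesis
    unfolding interval_order_on_def using assms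
    by (intro conjI exI[of _ "\<lambda>x. real (l x)"] exI[of _ "\<lambda>x. real (r x)"]) auto
qed

lemma canonical_rep_less_iff:
  assumes "canonical_rep A l r" "x \<in> A" "y \<in> A"
  shows "(x, y) \<in> order_of_rep A l r - Id \<longleftrightarrow> r x < l y"
  using assms by (fastforce simp: canonical_rep_def order_of_rep_def)

text \<open>Since \<open>l y\<close> is also a right endpoint, the counting clause applies to it,
  and the elements counted are those below \<open>y\<close>. Thus the order determines
  \<open>l\<close>.\<close>

lemma canonical_rep_left:
  assumes "canonical_rep A l r" "y \<in> A"
  shows "l y = card {x \<in> A. (x, y) \<in> order_of_rep A l r - Id}"
proof -
  have "l y \<in> r ` A"
    using assms unfolding canonical_rep_def by blast
  then obtain z where "z \<in> A" "l y = r z" by blast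
  moreover have "{x \<in> A. (x, y) \<in> order_of_rep A l r - Id} = {x \<in> A. r x < l y}"
    using canonical_rep_less_iff[OF assms(1) _ assms(2)] by blast
  ultimately show ?thesis
    using assms by (simp add: canonical_rep_def)
qed

text \<open>Some \<open>w\<close> has \<open>l w = r x\<close>. If \<open>r y < r x\<close>, this
  \<open>w\<close> lies above \<open>y\<close> but not above \<open>x\<close>, and any element so
  placed forces \<open>r y < r x\<close>. Thus the order determines \<open>r\<close>.\<close>

lemma canonical_rep_right:
  assumes "canonical_rep A l r" "x \<in> A"
  shows "r x = card {y \<in> A. \<exists>z\<in>A. (y, z) \<in> order_of_rep A l r - Id \<and>
                                  (x, z) \<notin> order_of_rep A l r - Id}"
proof -
  have "r x \<in> l ` A"
    using assms unfolding canonical_rep_def by blast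
  then obtain w where w: "w \<in> A" "r x = l w" by blast
  have "{y \<in> A. \<exists>z\<in>A. (y, z) \<in> order_of_rep A l r - Id \<and> (x, z) \<notin> order_of_rep A l r - Id}
      = {y \<in> A. \<exists>z\<in>A. r y < l z \<and> \<not> r x < l z}"
    using canonical_rep_less_iff[OF assms(1)] assms(2) by blast
  also have "\<dots> = {y \<in> A. r y < r x}"
    using w by (auto intro: bexI[of _ w])
  finally show ?thesis
    using assms by (simp add: canonical_rep_def)
qed

lemma canonical_rep_unique:
  assumes "canonical_rep A l r" "canonical_rep A l' r'"
    and "order_of_rep A l r = order_of_rep A l' r'" and "x \<in> A"
  shows "l x = l' x" "r x = r' x"
  using canonical_rep_left[OF assms(1,4)] canonical_rep_left[OF assms(2,4)]
    canonical_rep_right[OF assms(1,4)] canonical_rep_right[OF assms(2,4)] assms(3) by simp_all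

lemma ex_canonical_rep:
  assumes "finite A" and "interval_order_on A R"
  shows "\<exists>l r. canonical_rep A l r \<and> R = order_of_rep A l r"
proof -
  from assms(2) obtain a b :: "'a \<Rightarrow> real" where
    po: "partial_order_on A R" and ab: "\<And>z. z \<in> A \<Longrightarrow> a z \<le> b z"
    and less: "\<And>x y. x \<in> A \<Longrightarrow> y \<in> A \<Longrightarrow> ((x, y) \<in> R \<and> x \<noteq> y) \<longleftrightarrow> b x < a y"
    unfolding interval_order_on_def by blast
  \<comment> \<open>\<open>D z\<close> is the set of elements below \<open>z\<close>, and
    \<open>N x\<close> is the union of the \<open>D z\<close> over all \<open>z\<close> not above
    \<open>x\<close>. They grow with \<open>a z\<close> and \<open>b x\<close> respectively, so
    comparing cardinalities will amount to comparing sets.\<close>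
  define D where "D z = {y \<in> A. b y < a z}" for z
  define N where "N x = {y \<in> A. \<exists>z\<in>A. b y < a z \<and> \<not> b x < a z}" for x
  define l where "l y = card (D y)" for y
  define r where "r x = card (N x)" for x
  have fin: "finite (D z)" "finite (N z)" for z
    using assms(1) by (simp_all add: D_def N_def)
  have N_eq_D: "\<exists>z\<in>A. \<not> b x < a z \<and> N x = D z" if x: "x \<in> A" for x
  proof -
    let ?Z = "{z \<in> A. a z \<le> b x}"
    have "finite ?Z" "?Z \<noteq> {}" using assms(1) x ab by auto
    \<comment> \<open>Among the elements not above \<open>x\<close>, take one with the rightmost
      left endpoint: its \<open>D z\<close> contains all the others in the union.\<close>
    then obtain z where z: "z \<in> ?Z" "\<And>w. w \<in> ?Z \<Longrightarrow> a w \<le> a z"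
      using arg_min_if_finite[of ?Z "\<lambda>z. - a z"] by (force simp: not_less)
    have "N x = D z"
      using z by (fastforce simp: N_def D_def)
    with z(1) show ?thesis by (auto simp: not_less)
  qed
  have D_eq_N: "\<exists>x\<in>A. N x = D y" if y: "y \<in> A" for y
  proof -
    have "y \<notin> D y" using ab[OF y] by (simp add: D_def)
    then have "finite (A - D y)" "A - D y \<noteq> {}" using assms(1) y by auto
    \<comment> \<open>Among the elements not below \<open>y\<close>, take one with the leftmost
      right endpoint: whatever ends before it lies below \<open>y\<close>.\<close>
    then obtain x where x: "x \<in> A - D y" "\<And>w. w \<in> A - D y \<Longrightarrow> b x \<le> b w"
      using arg_min_if_finite[of "A - D y" b] by (force simp: not_less)
    have "N x = D y"
      using x y by (fastforce simp: N_def D_def)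
    with x show ?thesis by auto
  qed
  have rl: "r x < l y \<longleftrightarrow> b x < a y" if xy: "x \<in> A" "y \<in> A" for x y
  proof
    assume "b x < a y"
    \<comment> \<open>The inclusion is strict because \<open>x\<close> itself is in
      \<open>D y\<close> but not in \<open>N x\<close>.\<close>
    then have "N x \<subset> D y"
      using xy by (force simp: N_def D_def)
    then show "r x < l y"
      unfolding r_def l_def using fin psubset_card_mono by blast
  next
    assume less: "r x < l y"
    show "b x < a y"
    proof (rule ccontr)
      assume "\<not> b x < a y"
      then have "D y \<subseteq> N x" using xy by (auto simp: N_def D_def)
      then have "l y \<le> r x" unfolding r_def l_def using fin card_mono by blast
      with less show False by simp
    qed
  qed
  have "canonical_rep A l r"
    unfolding canonical_rep_def
  proof (intro conjI ballI)
    show "l ` A = r ` A"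
    proof (intro equalityI image_subsetI)
      fix x assume x: "x \<in> A"
      show "l x \<in> r ` A"
        using D_eq_N[OF x] unfolding l_def r_def by (metis imageI)
      show "r x \<in> l ` A"
        using N_eq_D[OF x] unfolding l_def r_def by (metis imageI)
    qed
    show "l x \<le> r x" if "x \<in> A" for x
      using rl[OF that that] ab[OF that] by linarith
    show "r x = card {y \<in> A. r y < r x}" if x: "x \<in> A" for x
    proof -
      obtain z where z: "z \<in> A" "N x = D z" using N_eq_D[OF x] by blast
      then have "r x = l z" by (simp add: l_def r_def)
      then have "{y \<in> A. r y < r x} = D z" using rl z(1) by (auto simp: D_def)
      then show ?thesis using z(2) by (simp add: r_def)
    qed
  qed
  moreover have "R = order_of_rep A l r"
  proof -
    have "R \<subseteq> A \<times> A" "refl_on A R"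
      using po by (auto simp: partial_order_on_def preorder_on_def)
    then have "(x, y) \<in> R \<longleftrightarrow> x \<in> A \<and> y \<in> A \<and> (x = y \<or> r x < l y)" for x y
      using less[of x y] rl[of x y] by (cases "x = y") (auto dest: refl_onD)
    then show ?thesis by (auto simp: order_of_rep_def)
  qed
  ultimately show ?thesis by blast
qed

section \<open>Canonical representations as permutations with a code\<close>

text \<open>These are inversion sequences; extensionality makes a code equal to any other with the
  same values on \<open>{1..n}\<close>, as the bijections require.\<close>

definition codes :: "nat \<Rightarrow> (nat \<Rightarrow> nat) set" where
  "codes n = (\<Pi>\<^sub>E m\<in>{1..n}. {..<m})"

definition left_end :: "(nat \<Rightarrow> nat) \<Rightarrow> (nat \<Rightarrow> nat) \<Rightarrow> nat \<Rightarrow> nat" where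
  "left_end p c x = c (inv p x)"

definition right_end :: "nat \<Rightarrow> (nat \<Rightarrow> nat) \<Rightarrow> (nat \<Rightarrow> nat) \<Rightarrow> nat \<Rightarrow> nat" where
  "right_end n p c x = Max {s \<in> c ` {1..n}. s < inv p x}"

lemma code_less: "c \<in> codes n \<Longrightarrow> m \<in> {1..n} \<Longrightarrow> c m < m"
  unfolding codes_def by blast

section \<open>From a permutation and a code to a canonical representation\<close>

context
  fixes n :: nat and p c :: "nat \<Rightarrow> nat"
  assumes p: "p permutes {1..n}" and c: "c \<in> codes n"
begin

lemma left_end_perm: "left_end p c (p i) = c i"
  by (simp add: left_end_def permutes_inverses[OF p])

lemma right_end_perm: "right_end n p c (p i) = Max {s \<in> c ` {1..n}. s < i}"
  by (simp add: right_end_def permutes_inverses[OF p])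

lemma right_end_in:
  assumes i: "i \<in> {1..n}"
  shows "right_end n p c (p i) \<in> c ` {1..n}" "right_end n p c (p i) < i"
proof -
  let ?T = "{s \<in> c ` {1..n}. s < i}"
  have "c i \<in> ?T" using code_less[OF c i] i by auto
  then have "Max ?T \<in> ?T" by (intro Max_in) auto
  then show "right_end n p c (p i) \<in> c ` {1..n}" "right_end n p c (p i) < i"
    by (simp_all add: right_end_perm)
qed

lemma right_end_ge: "s \<in> c ` {1..n} \<Longrightarrow> s < i \<Longrightarrow> s \<le> right_end n p c (p i)"
  by (auto simp: right_end_perm intro!: Max_ge)

lemma right_end_mono:
  assumes "i \<in> {1..n}" "i \<le> j"
  shows "right_end n p c (p i) \<le> right_end n p c (p j)"
  using right_end_in[OF assms(1)] right_end_ge assms(2) by auto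

lemma right_end_less_iff:
  assumes "s \<in> c ` {1..n}" "i \<in> {1..n}"
  shows "right_end n p c (p i) < s \<longleftrightarrow> i \<le> s"
  using right_end_in[OF assms(2)] right_end_ge[OF assms(1), of i] by linarith

lemma canonical_rep_ends: "canonical_rep {1..n} (left_end p c) (right_end n p c)"
proof -
  let ?l = "left_end p c" and ?r = "right_end n p c"
  have img: "f ` {1..n} = (\<lambda>i. f (p i)) ` {1..n}" for f :: "nat \<Rightarrow> nat"
    using permutes_image[OF p] by (metis image_image)
  have l: "?l ` {1..n} = c ` {1..n}"
    by (subst img) (simp add: left_end_perm)
  have r: "?r ` {1..n} = c ` {1..n}"
  proof -
    have "s \<in> (\<lambda>i. ?r (p i)) ` {1..n}" if s: "s \<in> c ` {1..n}" for s
    proof -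
      \<comment> \<open>A code value \<open>s\<close> reappears as the right endpoint at position
        \<open>Suc s\<close>, which exists because \<open>s < n\<close>.\<close>
      have "s < n" using s code_less[OF c] by fastforce
      then have i: "Suc s \<in> {1..n}" by simp
      have "?r (p (Suc s)) = s"
        using right_end_in(2)[OF i] right_end_ge[OF s, of "Suc s"] by simp
      with i show ?thesis by force
    qed
    then show ?thesis
      by (subst img) (use right_end_in(1) in blast)
  qed
  have "?l (p i) \<le> ?r (p i)" if "i \<in> {1..n}" for i
    using right_end_ge[of "c i" i] code_less[OF c that] that by (simp add: left_end_perm)
  moreover have "?r (p i) = card {y \<in> {1..n}. ?r y < ?r (p i)}" if i: "i \<in> {1..n}" for i
  proof -
    have "{y \<in> {1..n}. ?r y < ?r (p i)} = p ` {j \<in> {1..n}. ?r (p j) < ?r (p i)}"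
      by (subst permutes_image[OF p, symmetric]) blast
    \<comment> \<open>The right endpoint stays below a code value \<open>s\<close> at exactly the
      first \<open>s\<close> positions, which yields the counting clause.\<close>
    also have "{j \<in> {1..n}. ?r (p j) < ?r (p i)} = {1..?r (p i)}"
      using right_end_less_iff[OF right_end_in(1)[OF i]] right_end_in(2)[OF i] i by auto
    finally show ?thesis
      using card_image[OF inj_on_subset[OF permutes_inj[OF p]], of "{1..?r (p i)}"] by simp
  qed
  moreover have "\<exists>i\<in>{1..n}. x = p i" if "x \<in> {1..n}" for x
    using permutes_image[OF p] that by blast
  ultimately show ?thesis
    unfolding canonical_rep_def using l r by fast
qed

text \<open>
  Between two consecutive values of the code the right endpoint is constant and \<^term>\<open>p\<close> has no
  descent, so \<^term>\<open>p\<close> sorts by the right endpoint, breaking ties by label. The key is a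
  lexicographic pair packed into one number.
\<close>

lemma strict_mono_on_sort_key:
  assumes D: "descent_positions n p \<subseteq> c ` {1..n}"
  shows "strict_mono_on {1..n} ((\<lambda>x. right_end n p c x * Suc n + x) \<circ> p)"
proof -
  let ?k = "(\<lambda>x. right_end n p c x * Suc n + x) \<circ> p"
  have less_Suc: "?k i < ?k (Suc i)" if i: "i \<in> {1..n}" "Suc i \<in> {1..n}" for i
  proof (cases "right_end n p c (p i) < right_end n p c (p (Suc i))")
    case True
    then have "Suc (right_end n p c (p i)) * Suc n \<le> right_end n p c (p (Suc i)) * Suc n"
      by (intro mult_right_mono) auto
    moreover have "p i \<le> n" using permutes_in_image[OF p] i(1) by auto
    ultimately show ?thesis by simp
  next
    case False
    then have eq: "right_end n p c (p i) = right_end n p c (p (Suc i))"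
      using right_end_mono[OF i(1), of "Suc i"] by simp
    \<comment> \<open>A code value \<open>i\<close> would make the right endpoint rise from below
      \<open>i\<close> to at least \<open>i\<close> between positions \<open>i\<close> and
      \<open>Suc i\<close>.\<close>
    have "i \<notin> c ` {1..n}"
    proof
      assume "i \<in> c ` {1..n}"
      from right_end_ge[OF this, of "Suc i"] show False
        using right_end_in(2)[OF i(1)] eq by simp
    qed
    then have "\<not> p i > p (Suc i)"
      using D i by (auto simp: descent_positions_def)
    moreover have "p i \<noteq> p (Suc i)"
      by (simp add: inj_eq[OF permutes_inj[OF p]])
    ultimately show ?thesis using eq by simp
  qed
  show ?thesis
  proof (rule strict_mono_onI)
    fix i j assume ij: "i \<in> {1..n}" "j \<in> {1..n}" "i < j"
    from ij(3) have "Suc i \<le> j" by simp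
    then have "j \<le> n \<longrightarrow> ?k i < ?k j"
    proof (induction j rule: dec_induct)
      case base
      then show ?case using less_Suc[of i] ij(1) by simp
    next
      case (step j)
      then show ?case using less_Suc[of j] by fastforce
    qed
    then show "?k i < ?k j" using ij(2) by simp
  qed
qed

end

section \<open>From a canonical representation back to a permutation and a code\<close>

lemma sort_key_less:
  fixes r :: "nat \<Rightarrow> nat"
  assumes "x \<in> {1..n}" "y \<in> {1..n}" "r x < r y"
  shows "r x * Suc n + x < r y * Suc n + y"
proof -
  have "Suc (r x) * Suc n \<le> r y * Suc n"
    using assms(3) by (intro mult_right_mono) auto
  with assms(1) show ?thesis by simp
qed

lemma ex_perm_code_of_rep:
  assumes rep: "canonical_rep {1..n} l r"
  shows "\<exists>p c. p permutes {1..n} \<and> c \<in> codes n \<and> descent_positions n p \<subseteq> c ` {1..n} \<and>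
               (\<forall>x\<in>{1..n}. left_end p c x = l x \<and> right_end n p c x = r x)"
proof -
  let ?k = "\<lambda>x. r x * Suc n + x"
  have lr: "l ` {1..n} = r ` {1..n}" and le: "\<And>x. x \<in> {1..n} \<Longrightarrow> l x \<le> r x"
    and card: "\<And>x. x \<in> {1..n} \<Longrightarrow> r x = card {y \<in> {1..n}. r y < r x}"
    using rep by (auto simp: canonical_rep_def)
  have "inj_on ?k {1..n}"
  proof (rule inj_onI)
    fix x y assume "x \<in> {1..n}" "y \<in> {1..n}" "?k x = ?k y"
    then show "x = y"
      using sort_key_less[of x n y r] sort_key_less[of y n x r]
      by (cases "r x" "r y" rule: linorder_cases) auto
  qed
  then obtain p where p: "p permutes {1..n}" and mono: "strict_mono_on {1..n} (?k \<circ> p)"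
    using ex_strict_mono_on_permutes by blast
  have pin: "p i \<in> {1..n}" if "i \<in> {1..n}" for i
    using permutes_in_image[OF p] that by simp
  have surj: "\<exists>i\<in>{1..n}. x = p i" if "x \<in> {1..n}" for x
    using permutes_image[OF p] that by blast
  have card_p: "card (p ` I) = card I" for I
    using card_image[OF inj_on_subset[OF permutes_inj[OF p]]] by simp
  have r_mono: "r (p i) \<le> r (p j)" if "i \<in> {1..n}" "j \<in> {1..n}" "i \<le> j" for i j
    using sort_key_less[OF pin[OF that(2)] pin[OF that(1)], of r] strict_mono_on_leD[OF mono that]
    by (auto simp: not_less[symmetric])
  \<comment> \<open>Only earlier positions can carry a smaller \<open>r\<close>, so the counting
    clause gives at most \<open>i - 1\<close>.\<close>
  have r_less: "r (p i) < i" if i: "i \<in> {1..n}" for i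
  proof -
    have "{y \<in> {1..n}. r y < r (p i)} \<subseteq> p ` {1..<i}"
    proof
      fix y assume y: "y \<in> {y \<in> {1..n}. r y < r (p i)}"
      then obtain j where j: "j \<in> {1..n}" "y = p j" using surj by blast
      with y have "j < i" using r_mono[OF i j(1)] by (auto simp: not_less[symmetric])
      with j show "y \<in> p ` {1..<i}" by auto
    qed
    then have "card {y \<in> {1..n}. r y < r (p i)} \<le> card (p ` {1..<i})"
      by (intro card_mono) auto
    then have "r (p i) \<le> card (p ` {1..<i})"
      by (simp only: card[OF pin[OF i], symmetric])
    then show ?thesis using card_p[of "{1..<i}"] i by auto
  qed
  \<comment> \<open>All of the first \<open>i\<close> positions are counted by
    \<open>r (p j)\<close>. Hence no value of \<open>r\<close> lies strictly between
    \<open>r (p i)\<close> and \<open>i\<close>, and a rise from position \<open>i\<close> to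
    \<open>Suc i\<close> leads exactly to the value \<open>i\<close>.\<close>
  have r_ge: "i \<le> r (p j)" if ij: "i \<in> {1..n}" "j \<in> {1..n}" "r (p i) < r (p j)" for i j
  proof -
    have "p ` {1..i} \<subseteq> {y \<in> {1..n}. r y < r (p j)}"
    proof
      fix y assume "y \<in> p ` {1..i}"
      then obtain h where "h \<in> {1..n}" "h \<le> i" "y = p h" using ij(1) by auto
      then show "y \<in> {y \<in> {1..n}. r y < r (p j)}"
        using pin[of h] r_mono[OF _ ij(1), of h] ij(3) by simp
    qed
    then have "card (p ` {1..i}) \<le> card {y \<in> {1..n}. r y < r (p j)}"
      by (intro card_mono) auto
    then have "card (p ` {1..i}) \<le> r (p j)"
      by (simp only: card[OF pin[OF ij(2)], symmetric])
    then show ?thesis using card_p[of "{1..i}"] by simp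
  qed
  define c where "c = (\<lambda>i\<in>{1..n}. l (p i))"
  have c: "c \<in> codes n"
    unfolding codes_def c_def using le_less_trans[OF le[OF pin] r_less] by auto
  have img: "c ` {1..n} = r ` {1..n}"
  proof -
    have "c ` {1..n} = l ` p ` {1..n}" by (auto simp: c_def image_iff)
    then show ?thesis using permutes_image[OF p] lr by simp
  qed
  have left: "left_end p c (p i) = l (p i)" if "i \<in> {1..n}" for i
    unfolding left_end_perm[OF p c] using that by (simp add: c_def)
  have right: "right_end n p c (p i) = r (p i)" if i: "i \<in> {1..n}" for i
    unfolding right_end_perm[OF p c] img
  proof (rule Max_eqI)
    fix s assume "s \<in> {s \<in> r ` {1..n}. s < i}"
    then obtain j where "j \<in> {1..n}" "s = r (p j)" "s < i" using surj by blast
    then show "s \<le> r (p i)" using r_ge[OF i, of j] by (auto simp: not_less[symmetric])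
  qed (use r_less[OF i] pin[OF i] in auto)
  have "i \<in> c ` {1..n}" if i: "i \<in> descent_positions n p" for i
  proof -
    have i': "i \<in> {1..n}" "Suc i \<in> {1..n}" "p (Suc i) < p i"
      using i by (auto simp: descent_positions_def)
    have "r (p i) < r (p (Suc i))"
    proof (rule ccontr)
      assume "\<not> r (p i) < r (p (Suc i))"
      then have "r (p i) = r (p (Suc i))" using r_mono[OF i'(1,2)] by simp
      then show False using strict_mono_onD[OF mono i'(1,2)] i'(3) by simp
    qed
    then have "r (p (Suc i)) = i"
      using r_ge[OF i'(1,2)] r_less[OF i'(2)] by simp
    then show ?thesis unfolding img using pin[OF i'(2)] by force
  qed
  moreover have "\<forall>x\<in>{1..n}. left_end p c x = l x \<and> right_end n p c x = r x"
    using left right surj by metis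
  ultimately show ?thesis
    using p c by blast
qed

definition order_of_perm_code :: "nat \<Rightarrow> (nat \<Rightarrow> nat) \<times> (nat \<Rightarrow> nat) \<Rightarrow> nat rel" where
  "order_of_perm_code n = (\<lambda>(p, c). order_of_rep {1..n} (left_end p c) (right_end n p c))"

text \<open>For injectivity, the order determines both endpoint functions; the right one determines
  \<open>p\<close> as the sorting permutation of its key, and the left one read along
  \<open>p\<close> is \<open>c\<close>.\<close>

lemma bij_betw_order_of_perm_code:
  "bij_betw (order_of_perm_code n)
     {(p, c). p permutes {1..n} \<and> c \<in> codes n \<and> descent_positions n p \<subseteq> c ` {1..n}}
     (labeled_interval_orders n)"
  (is "bij_betw ?F ?X _")
  unfolding bij_betw_def
proof (intro conjI equalityI subsetI)
  show "inj_on ?F ?X"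
  proof (rule inj_onI, clarify)
    fix p c p' c'
    assume p: "p permutes {1..n}" and c: "c \<in> codes n" and D: "descent_positions n p \<subseteq> c ` {1..n}"
      and p': "p' permutes {1..n}" and c': "c' \<in> codes n"
      and D': "descent_positions n p' \<subseteq> c' ` {1..n}"
      and eq: "?F (p, c) = ?F (p', c')"
    have lr: "left_end p c x = left_end p' c' x" "right_end n p c x = right_end n p' c' x"
      if "x \<in> {1..n}" for x
      using canonical_rep_unique[OF canonical_rep_ends[OF p c] canonical_rep_ends[OF p' c'] _ that] eq
      by (simp_all add: order_of_perm_code_def)
    have "strict_mono_on {1..n} ((\<lambda>x. right_end n p c x * Suc n + x) \<circ> p')"
      using strict_mono_on_sort_key[OF p' c' D'] lr(2) permutes_in_image[OF p']
      by (simp add: strict_mono_on_def)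
    then have pp: "p = p'"
      using strict_mono_on_permutes_unique[OF p strict_mono_on_sort_key[OF p c D] p'] by blast
    moreover have "c = c'"
    proof (rule PiE_ext[OF c[unfolded codes_def] c'[unfolded codes_def]])
      fix i assume "i \<in> {1..n}"
      then show "c i = c' i"
        using lr(1)[of "p i"] left_end_perm[OF p c] left_end_perm[OF p' c'] pp
          permutes_in_image[OF p] by simp
    qed
    ultimately show "p = p' \<and> c = c'" by simp
  qed
next
  fix R assume "R \<in> ?F ` ?X"
  then obtain p c where "p permutes {1..n}" "c \<in> codes n" and R: "R = ?F (p, c)" by blast
  then have "canonical_rep {1..n} (left_end p c) (right_end n p c)"
    using canonical_rep_ends by blast
  then have "\<And>x. x \<in> {1..n} \<Longrightarrow> left_end p c x \<le> right_end n p c x"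
    by (simp add: canonical_rep_def)
  then show "R \<in> labeled_interval_orders n"
    unfolding R order_of_perm_code_def labeled_interval_orders_def prod.case mem_Collect_eq
    using interval_order_on_order_of_rep by blast
next
  fix R assume "R \<in> labeled_interval_orders n"
  then obtain l r where rep: "canonical_rep {1..n} l r" and R: "R = order_of_rep {1..n} l r"
    using ex_canonical_rep[of "{1..n}" R] by (auto simp: labeled_interval_orders_def)
  obtain p c where pc: "p permutes {1..n}" "c \<in> codes n" "descent_positions n p \<subseteq> c ` {1..n}"
    and lr: "\<forall>x\<in>{1..n}. left_end p c x = l x \<and> right_end n p c x = r x"
    using ex_perm_code_of_rep[OF rep] by blast
  have "?F (p, c) = R"
    unfolding R order_of_perm_code_def using lr by (auto simp: order_of_rep_def)
  with pc show "R \<in> ?F ` ?X" by force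
qed

section \<open>Ascent bottoms and nearest smaller values\<close>

text \<open>
  Position 0 serves as a sentinel: a permutation of \<^term>\<open>{1..n}\<close> fixes 0, so the value is 0
  if no smaller value precedes \<^term>\<open>m\<close>.
\<close>

definition nearest_smaller :: "nat \<Rightarrow> (nat \<Rightarrow> nat) \<Rightarrow> nat \<Rightarrow> nat" where
  "nearest_smaller n q = (\<lambda>m\<in>{1..n}. q (Max {i. i < inv q m \<and> q i < m}))"

lemma nearest_smaller_perm:
  assumes q: "q permutes {1..n}" and j: "j \<in> {1..n}"
  obtains k where "k < j" "q k < q j" "nearest_smaller n q (q j) = q k"
    "\<And>i. k < i \<Longrightarrow> i < j \<Longrightarrow> q j < q i"
proof -
  let ?T = "{i. i < j \<and> q i < q j}"
  have "q j \<in> {1..n}" using permutes_in_image[OF q] j by simp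
  moreover have "q 0 = 0" using permutes_not_in[OF q] by simp
  ultimately have "0 \<in> ?T" using j by auto
  then have k: "Max ?T \<in> ?T" by (intro Max_in) auto
  have "q j < q i" if "Max ?T < i" "i < j" for i
  proof -
    have "i \<notin> ?T" using that(1) Max_ge[of ?T i] by (auto simp: not_less[symmetric])
    moreover have "q i \<noteq> q j" using that(2) by (simp add: inj_eq[OF permutes_inj[OF q]])
    ultimately show ?thesis using that(2) by auto
  qed
  moreover have "nearest_smaller n q (q j) = q (Max ?T)"
    using \<open>q j \<in> {1..n}\<close> by (simp add: nearest_smaller_def permutes_inverses[OF q])
  ultimately show ?thesis using k that by blast
qed

lemma nearest_smaller_in_codes:
  assumes q: "q permutes {1..n}"
  shows "nearest_smaller n q \<in> codes n"
proof -
  have "nearest_smaller n q m < m" if m: "m \<in> {1..n}" for m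
  proof -
    obtain j where "j \<in> {1..n}" "m = q j" using m permutes_image[OF q] by blast
    then show ?thesis using nearest_smaller_perm[OF q, of j] by metis
  qed
  then show ?thesis by (auto simp: codes_def nearest_smaller_def)
qed

text \<open>Just after the last entry smaller than \<open>q j\<close> stands either
  \<open>q j\<close> or a larger entry, so that last entry is an ascent bottom. Conversely, an
  ascent bottom is the nearest smaller value of its successor. Removing 0 discards the
  sentinel.\<close>

lemma nearest_smaller_image:
  assumes q: "q permutes {1..n}"
  shows "nearest_smaller n q ` {1..n} - {0} = ascent_bottoms n q"
proof (intro equalityI subsetI)
  fix s assume s: "s \<in> nearest_smaller n q ` {1..n} - {0}"
  then have "s \<in> nearest_smaller n q ` q ` {1..n}"
    unfolding permutes_image[OF q] by blast
  then obtain j where j: "j \<in> {1..n}" "s = nearest_smaller n q (q j)" by blast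
  obtain k where k: "k < j" "q k < q j" "s = q k" "\<And>i. k < i \<Longrightarrow> i < j \<Longrightarrow> q j < q i"
    using nearest_smaller_perm[OF q j(1)] j(2) by metis
  have "k \<noteq> 0"
  proof
    assume "k = 0"
    then show False using s k(3) permutes_not_in[OF q, of 0] by simp
  qed
  then have "k \<in> {1..n - 1}" using k(1) j(1) by auto
  moreover have "q k < q (k + 1)"
    using k(1,2) k(4)[of "Suc k"] by (cases "Suc k = j") auto
  ultimately show "s \<in> ascent_bottoms n q" using k(3) by (auto simp: ascent_bottoms_def)
next
  fix s assume "s \<in> ascent_bottoms n q"
  then obtain i where i: "i \<in> {1..n - 1}" "q i < q (Suc i)" "s = q i"
    by (auto simp: ascent_bottoms_def)
  then have Suc: "Suc i \<in> {1..n}" and "i \<in> {1..n}" by auto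
  then have in_n: "q i \<in> {1..n}" "q (Suc i) \<in> {1..n}"
    using permutes_in_image[OF q] by blast+
  obtain k where "k < Suc i" "nearest_smaller n q (q (Suc i)) = q k"
    "\<And>j. k < j \<Longrightarrow> j < Suc i \<Longrightarrow> q (Suc i) < q j"
    using nearest_smaller_perm[OF q Suc] by metis
  with i(2) have "nearest_smaller n q (q (Suc i)) = s"
    unfolding i(3) by (metis less_Suc_eq less_asym)
  with in_n i(3) show "s \<in> nearest_smaller n q ` {1..n} - {0}" by force
qed

text \<open>
  The values between the nearest smaller value of \<^term>\<open>m\<close> and \<^term>\<open>m\<close> itself all exceed
  \<^term>\<open>m\<close>, so the relative order of \<^term>\<open>{..m}\<close> is determined by that of \<^term>\<open>{..<m}\<close>.
\<close>

lemma nearest_smaller_pos: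
  assumes q: "q permutes {1..n}" and m: "m \<in> {1..n}" and k: "k < m"
  shows "inv q k < inv q m \<longleftrightarrow> k = nearest_smaller n q m \<or> inv q k < inv q (nearest_smaller n q m)"
proof -
  obtain j where j: "j \<in> {1..n}" "m = q j" using m permutes_image[OF q] by blast
  obtain h where h: "h < j" "q h < q j" "nearest_smaller n q m = q h"
    "\<And>i. h < i \<Longrightarrow> i < j \<Longrightarrow> q j < q i"
    using nearest_smaller_perm[OF q j(1)] j(2) by metis
  define i where "i = inv q k"
  have ki: "k = q i" by (simp add: i_def permutes_inverses[OF q])
  have "i < j \<longleftrightarrow> i = h \<or> i < h"
    using h(1,4) k j(2) ki by (meson less_asym less_trans linorder_neqE_nat)
  moreover have "q i = q h \<longleftrightarrow> i = h" by (simp add: inj_eq[OF permutes_inj[OF q]])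
  ultimately show ?thesis
    unfolding j(2) ki h(3)[unfolded j(2)] by (simp add: permutes_inverses[OF q])
qed

text \<open>Insert the values in increasing order: \<open>Suc m\<close> enters the word on the
  smaller values directly after its nearest smaller value, which is the same for both
  permutations.\<close>

lemma nearest_smaller_order:
  assumes p: "p permutes {1..n}" and q: "q permutes {1..n}"
    and eq: "nearest_smaller n p = nearest_smaller n q"
  shows "m \<le> n \<Longrightarrow> a \<le> m \<Longrightarrow> b \<le> m \<Longrightarrow> inv p a < inv p b \<longleftrightarrow> inv q a < inv q b"
proof (induction m arbitrary: a b)
  case (Suc m)
  have m: "Suc m \<in> {1..n}" using Suc.prems(1) by simp
  have le: "nearest_smaller n q (Suc m) \<le> m"
    using code_less[OF nearest_smaller_in_codes[OF q] m] by simp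
  have below: "inv p k < inv p (Suc m) \<longleftrightarrow> inv q k < inv q (Suc m)" if k: "k \<le> m" for k
    using nearest_smaller_pos[OF p m, of k] nearest_smaller_pos[OF q m, of k] k eq
      Suc.IH[OF _ k le] Suc.prems(1) by simp
  have neq: "inv p k \<noteq> inv p (Suc m)" "inv q k \<noteq> inv q (Suc m)" if "k \<le> m" for k
    using that inj_eq[OF permutes_inj[OF permutes_inv[OF p]]]
      inj_eq[OF permutes_inj[OF permutes_inv[OF q]]] by simp_all
  consider "a \<le> m" "b \<le> m" | "a \<le> m" "b = Suc m" | "a = Suc m" "b \<le> m" | "a = Suc m" "b = Suc m"
    using Suc.prems by linarith
  then show ?case
  proof cases
    case 1
    then show ?thesis using Suc by simp
  next
    case 2
    then show ?thesis using below by simp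
  next
    case 3
    then show ?thesis using below[of b] neq[of b] by (metis less_asym linorder_neqE_nat)
  qed simp
qed simp

lemma inj_on_nearest_smaller: "inj_on (nearest_smaller n) {q. q permutes {1..n}}"
proof (rule inj_onI, clarify)
  fix p q
  assume p: "p permutes {1..n}" and q: "q permutes {1..n}"
    and eq: "nearest_smaller n p = nearest_smaller n q"
  \<comment> \<open>Both permutations sort the key \<open>inv p\<close>: \<open>p\<close> because
    the composite is the identity, \<open>q\<close> because relative positions agree.\<close>
  have "strict_mono_on {1..n} (inv p \<circ> q)"
  proof (rule strict_mono_onI)
    fix i j assume ij: "i \<in> {1..n}" "j \<in> {1..n}" "i < j"
    then have "q i \<in> {1..n}" "q j \<in> {1..n}" by (simp_all only: permutes_in_image[OF q])
    then have "q i \<le> n" "q j \<le> n" by simp_all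
    then show "(inv p \<circ> q) i < (inv p \<circ> q) j"
      using nearest_smaller_order[OF p q eq order_refl, of "q i" "q j"] ij(3)
      by (simp add: permutes_inverses[OF q])
  qed
  moreover have "strict_mono_on {1..n} (inv p \<circ> p)"
    by (rule strict_mono_onI) (simp add: permutes_inverses[OF p])
  ultimately show "p = q"
    using strict_mono_on_permutes_unique[OF p _ q] by blast
qed

text \<open>A code has \<open>m\<close> choices at each \<open>m\<close>, so there are
  \<open>n!\<close> codes, as many as permutations; injectivity then gives surjectivity without an
  explicit inverse.\<close>

lemma bij_betw_nearest_smaller:
  "bij_betw (nearest_smaller n) {q. q permutes {1..n}} (codes n)"
  unfolding bij_betw_def
proof (intro conjI card_subset_eq inj_on_nearest_smaller)
  show "finite (codes n)" by (auto simp: codes_def intro: finite_PiE)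
  show "nearest_smaller n ` {q. q permutes {1..n}} \<subseteq> codes n"
    using nearest_smaller_in_codes by blast
  show "card (nearest_smaller n ` {q. q permutes {1..n}}) = card (codes n)"
    by (simp add: card_image[OF inj_on_nearest_smaller] card_permutations codes_def card_PiE
        fact_prod del: One_nat_def)
qed

lemma bij_betw_map_nearest_smaller:
  "bij_betw (map_prod id (nearest_smaller n))
     {(p, q). p permutes {1..n} \<and> q permutes {1..n} \<and> descent_positions n p \<subseteq> ascent_bottoms n q}
     {(p, c). p permutes {1..n} \<and> c \<in> codes n \<and> descent_positions n p \<subseteq> c ` {1..n}}"
  (is "bij_betw ?g ?Y ?X")
proof -
  let ?P = "{p. p permutes {1..n}}"
  have iff: "descent_positions n p \<subseteq> ascent_bottoms n q \<longleftrightarrow>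
             descent_positions n p \<subseteq> nearest_smaller n q ` {1..n}" if "q permutes {1..n}" for p q
  proof -
    \<comment> \<open>Since 0 is not a descent position, removing the sentinel value from the image
      leaves the inclusion unchanged.\<close>
    have "0 \<notin> descent_positions n p" by (simp add: descent_positions_def)
    then show ?thesis unfolding nearest_smaller_image[OF that, symmetric] by blast
  qed
  have "bij_betw ?g (?P \<times> ?P) (?P \<times> codes n)"
    by (intro bij_betw_map_prod bij_betw_nearest_smaller bij_betw_id)
  moreover have "?Y \<subseteq> ?P \<times> ?P" by blast
  moreover have "?g ` ?Y = ?X"
  proof -
    have "?X \<subseteq> ?g ` ?Y"
    proof clarify
      fix p c assume pc: "p permutes {1..n}" "c \<in> codes n" "descent_positions n p \<subseteq> c ` {1..n}"
      then obtain q where "q permutes {1..n}" "c = nearest_smaller n q"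
        using bij_betw_imp_surj_on[OF bij_betw_nearest_smaller] by blast
      with pc show "(p, c) \<in> ?g ` ?Y"
        by (intro image_eqI[of _ _ "(p, q)"]) (simp_all add: iff)
    qed
    moreover have "?g ` ?Y \<subseteq> ?X"
    proof (rule image_subsetI)
      fix u assume "u \<in> ?Y"
      then obtain p q where "u = (p, q)" "p permutes {1..n}" "q permutes {1..n}"
        "descent_positions n p \<subseteq> ascent_bottoms n q" by blast
      then show "?g u \<in> ?X"
        using iff[of q p] nearest_smaller_in_codes[of q n] by simp
    qed
    ultimately show ?thesis by blast
  qed
  ultimately show ?thesis by (rule bij_betw_subset)
qed

section \<open>Interval orders as pairs of permutations\<close>

lemma ascent_bottoms_subset:
  assumes "q permutes {1..n}"
  shows "ascent_bottoms n q \<subseteq> {1..n - 1}"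
proof
  fix s assume "s \<in> ascent_bottoms n q"
  then obtain i where i: "i \<in> {1..n - 1}" "q i < q (i + 1)" "s = q i"
    by (auto simp: ascent_bottoms_def)
  then have "i \<in> {1..n}" "i + 1 \<in> {1..n}" by auto
  then have "q i \<in> {1..n}" "q (i + 1) \<in> {1..n}" using permutes_in_image[OF assms] by blast+
  with i show "s \<in> {1..n - 1}" by auto
qed

text \<open>The index \<open>S\<close> is forced to be \<open>ascent_bottoms n q\<close>, so it can
  be restored after being forgotten.\<close>

lemma bij_betw_snd_descents_ascents:
  "bij_betw snd
     (SIGMA S : Pow {1..n - 1}. perms_descents_within n S \<times> perms_ascent_bottoms_eq n S)
     {(p, q). p permutes {1..n} \<and> q permutes {1..n} \<and>
              descent_positions n p \<subseteq> ascent_bottoms n q}"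
  by (rule bij_betw_byWitness[where f' = "\<lambda>(p, q). (ascent_bottoms n q, p, q)"])
    (use ascent_bottoms_subset in
      \<open>auto simp: perms_descents_within_def perms_ascent_bottoms_eq_def\<close>)

theorem theorem18:
  fixes n :: nat
  assumes "n \<ge> 1"
  shows "(\<exists>f. bij_betw f (labeled_interval_orders n)
              (SIGMA S : Pow {1..n - 1}. perms_descents_within n S \<times> perms_ascent_bottoms_eq n S))
       \<and> bij_betw snd
              (SIGMA S : Pow {1..n - 1}. perms_descents_within n S \<times> perms_ascent_bottoms_eq n S)
              {(p, q). p permutes {1..n} \<and> q permutes {1..n} \<and>
                       descent_positions n p \<subseteq> ascent_bottoms n q}"
  using bij_betw_snd_descents_ascents
    bij_betw_inv[OF bij_betw_trans[OF bij_betw_trans[OF bij_betw_snd_descents_ascents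
      bij_betw_map_nearest_smaller] bij_betw_order_of_perm_code]]
  by blast

end
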